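(* Let $a,b,c,d\in\mathbb{C}$ with $ad-bc=1$, let $g(z)=\dfrac{az+b}{cz+d}$ be the corresponding Möbius map of $\mathbb{C}_\infty$, and suppose that $g$ is not a chordal isometry. Let $R_\chi$ be the reflection across the chordal isometric circle $C_g^\chi$ of $g$, and let $S_\chi$ be the chordal isometry with $g=S_\chi R_\chi$. Then $S_\chi$ and $R_\chi$ are explicitly given by $$S_\chi(z)=\frac{(b+\bar c)\bar z-(a-\bar d)}{-(\bar a-d)\bar z-(\bar b+c)},\qquad R_\chi(z)=\frac{(\bar a b+\bar c d)\bar z-[1-(|b|^2+|d|^2)]}{[1-(|a|^2+|c|^2)]\bar z-(a\bar b+c\bar d)}.$$ Moreover, when $|a|^2+|c|^2\neq 1$, $C_g^\chi$ is the Euclidean circle $|z-z_\chi|=r$, where $$z_\chi=\frac{\bar a b+\bar c d}{1-(|a|^2+|c|^2)},\qquad r=\frac{\sqrt{|a|^2+|b|^2+|c|^2+|d|^2-2}}{\big|1-(|a|^2+|c|^2)\big|}.$$ When $|a|^2+|c|^2=1$, $C_g^\chi$ is the Euclidean line (with $\infty$ attached) given by $$2\operatorname{Re}\big((a\bar b+c\bar d)z\big)=1-(|b|^2+|d|^2).$$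
   Context: $\mathbb{C}_\infty=\mathbb{C}\cup\{\infty\}$ is the Riemann sphere, with the chordal distance $$\chi(z,w)=\frac{2|z-w|}{\sqrt{1+|z|^2}\sqrt{1+|w|^2}},\qquad \chi(z,\infty)=\frac{2}{\sqrt{1+|z|^2}}.$$ A chordal isometry is a (possibly orientation-reversing) isometry of the metric space $(\mathbb{C}_\infty,\chi)$ onto itself; for example $z\mapsto\bar z$ is a chordal isometry. For a Möbius map $g(z)=(az+b)/(cz+d)$ with $ad-bc=1$, the chordal derivative is $g^\chi(z)=\lim_{w\to z}\chi(g(w),g(z))/\chi(w,z)$; explicitly $$g^\chi(z)=\frac{1+|z|^2}{|az+b|^2+|cz+d|^2}\ (z\in\mathbb{C}),\qquad g^\chi(\infty)=\frac{1}{|a|^2+|c|^2}.$$ The chordal isometric circle of $g$ is $C_g^\chi=\{z\in\mathbb{C}_\infty: g^\chi(z)=1\}$. When $g$ is not a chordal isometry, $C_g^\chi$ is either a Euclidean circle or a Euclidean line with $\infty$ attached. The reflection across a Euclidean circle $|z-z_0|=r$ is the inversion $z\mapsto z_0+r^2/(\bar z-\bar z_0)$ (interchanging $z_0$ and $\infty$); the reflection across a Euclidean line with $\infty$ attached is the usual Euclidean reflection in the line, fixing $\infty$. Since $R_\chi$ is an involution, $S_\chi$ is the map $gR_\chi$. Fractional expressions in $\bar z$ are extended to $\mathbb{C}_\infty$ with the usual conventions at $\infty$ and at zeros of the denominator. *)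

theory Defs
  imports "HOL-Analysis.Analysis"
begin

datatype riemann_sphere = Fin complex | Infty

(* Stereographic embedding onto the unit sphere, used only for the triangle inequality. *)
fun stereo :: "riemann_sphere \<Rightarrow> complex \<times> real" where
  "stereo (Fin z) = ((2 / (1 + (norm z)\<^sup>2)) *\<^sub>R z, ((norm z)\<^sup>2 - 1) / ((norm z)\<^sup>2 + 1))"
| "stereo Infty = (0, 1)"

instantiation riemann_sphere :: metric_space
begin

(* The chordal distance. *)
fun dist_riemann_sphere :: "riemann_sphere \<Rightarrow> riemann_sphere \<Rightarrow> real" where
  "dist_riemann_sphere (Fin z) (Fin w) =
     2 * norm (z - w) / (sqrt (1 + (norm z)\<^sup>2) * sqrt (1 + (norm w)\<^sup>2))"
| "dist_riemann_sphere (Fin z) Infty = 2 / sqrt (1 + (norm z)\<^sup>2)"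
| "dist_riemann_sphere Infty (Fin w) = 2 / sqrt (1 + (norm w)\<^sup>2)"
| "dist_riemann_sphere Infty Infty = 0"

definition uniformity_riemann_sphere :: "(riemann_sphere \<times> riemann_sphere) filter" where
  "uniformity_riemann_sphere = (INF e\<in>{0<..}. principal {(x, y). dist x y < e})"

definition open_riemann_sphere :: "riemann_sphere set \<Rightarrow> bool" where
  "open_riemann_sphere U \<longleftrightarrow> (\<forall>x\<in>U. \<forall>\<^sub>F (x', y) in uniformity. x' = x \<longrightarrow> y \<in> U)"

instance
proof
  have fin: "dist (stereo (Fin z)) (stereo (Fin w)) = dist (Fin z) (Fin w)" for z w
  proof -
    define p q where "p = 1 + (norm z)\<^sup>2" and "q = 1 + (norm w)\<^sup>2"
    have pq: "p > 0" "q > 0" by (auto simp: p_def q_def add_pos_nonneg)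
    have "(dist (stereo (Fin z)) (stereo (Fin w)))\<^sup>2
        = (norm ((2/p) *\<^sub>R z - (2/q) *\<^sub>R w))\<^sup>2 + ((p-2)/p - (q-2)/q)\<^sup>2"
      by (simp add: dist_prod_def dist_norm p_def q_def algebra_simps)
    also have "(norm ((2/p) *\<^sub>R z - (2/q) *\<^sub>R w))\<^sup>2
        = 4 * (p-1) / p\<^sup>2 - 8 * (z \<bullet> w) / (p * q) + 4 * (q-1) / q\<^sup>2"
      unfolding power2_norm_eq_inner inner_diff inner_scaleR_left inner_scaleR_right
      by (simp add: inner_diff inner_commute p_def q_def power2_norm_eq_inner[symmetric]
          power2_eq_square algebra_simps)
    also have "((p-2)/p - (q-2)/q) = 2/q - 2/p"
      using pq by (simp add: field_simps)
    also have "4 * (p-1) / p\<^sup>2 - 8 * (z \<bullet> w) / (p * q) + 4 * (q-1) / q\<^sup>2 + (2/q - 2/p)\<^sup>2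
        = 4 * (p - 1 + (q - 1) - 2 * (z \<bullet> w)) / (p * q)"
      using pq by (simp add: field_simps power2_eq_square)
    also have "p - 1 + (q - 1) - 2 * (z \<bullet> w) = (norm (z - w))\<^sup>2"
      by (simp add: p_def q_def power2_norm_eq_inner inner_diff inner_commute)
    also have "4 * (norm (z - w))\<^sup>2 / (p * q) = (dist (Fin z) (Fin w))\<^sup>2"
      using pq by (simp add: p_def q_def power_divide power_mult_distrib)
    finally show ?thesis
      by (rule power2_eq_imp_eq) (auto simp: zero_le_dist)
  qed
  have inf: "dist (stereo (Fin z)) (stereo Infty) = dist (Fin z) Infty" for z
  proof -
    define p where "p = 1 + (norm z)\<^sup>2"
    have p: "p > 0" by (auto simp: p_def add_pos_nonneg)
    have "(dist (stereo (Fin z)) (stereo Infty))\<^sup>2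
        = (norm ((2/p) *\<^sub>R z))\<^sup>2 + ((p-2)/p - 1)\<^sup>2"
      by (simp add: dist_prod_def dist_norm p_def algebra_simps)
    also have "(norm ((2/p) *\<^sub>R z))\<^sup>2 = 4 * (p-1) / p\<^sup>2"
      by (simp add: p_def power_divide power_mult_distrib)
    also have "4 * (p-1) / p\<^sup>2 + ((p-2)/p - 1)\<^sup>2 = 4 / p"
      using p by (simp add: field_simps power2_eq_square)
    also have "4 / p = (dist (Fin z) Infty)\<^sup>2"
      using p by (simp add: p_def power_divide)
    finally show ?thesis
      by (rule power2_eq_imp_eq) auto
  qed
  have eq: "dist x y = dist (stereo x) (stereo y)" for x y
    using fin inf inf[symmetric] by (cases x; cases y) (simp_all add: dist_commute)
  show "dist x y = 0 \<longleftrightarrow> x = y" for x y :: riemann_sphere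
  proof -
    have "1 + (norm z)\<^sup>2 > 0" for z :: complex by (simp add: add_pos_nonneg)
    then have "1 + (norm z)\<^sup>2 \<noteq> 0" for z :: complex by (metis less_irrefl)
    then show ?thesis by (cases x; cases y) auto
  qed
  show "dist x y \<le> dist x z + dist y z" for x y z :: riemann_sphere
    unfolding eq by (rule dist_triangle2)
qed (simp_all add: uniformity_riemann_sphere_def open_riemann_sphere_def)

end

definition chordal_isometry :: "(riemann_sphere \<Rightarrow> riemann_sphere) \<Rightarrow> bool" where
  "chordal_isometry f \<longleftrightarrow> surj f \<and> (\<forall>z w. dist (f z) (f w) = dist z w)"

(* z \<mapsto> (a z + b) / (c z + d); meaningful only when a d - b c \<noteq> 0. *)
fun moebius_map :: "complex \<Rightarrow> complex \<Rightarrow> complex \<Rightarrow> complex \<Rightarrow> riemann_sphere \<Rightarrow> riemann_sphere" where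
  "moebius_map a b c d (Fin z) = (if c * z + d = 0 then Infty else Fin ((a * z + b) / (c * z + d)))"
| "moebius_map a b c d Infty = (if c = 0 then Infty else Fin (a / c))"

fun cnj_sphere :: "riemann_sphere \<Rightarrow> riemann_sphere" where
  "cnj_sphere (Fin z) = Fin (cnj z)"
| "cnj_sphere Infty = Infty"

(* z \<mapsto> (a cnj z + b) / (c cnj z + d); meaningful only when a d - b c \<noteq> 0. *)
definition anti_moebius_map ::
    "complex \<Rightarrow> complex \<Rightarrow> complex \<Rightarrow> complex \<Rightarrow> riemann_sphere \<Rightarrow> riemann_sphere" where
  "anti_moebius_map a b c d z = moebius_map a b c d (cnj_sphere z)"

definition chordal_deriv :: "(riemann_sphere \<Rightarrow> riemann_sphere) \<Rightarrow> riemann_sphere \<Rightarrow> real" where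
  "chordal_deriv g z = Lim (at z) (\<lambda>w. dist (g w) (g z) / dist w z)"

definition chordal_isometric_circle :: "(riemann_sphere \<Rightarrow> riemann_sphere) \<Rightarrow> riemann_sphere set" where
  "chordal_isometric_circle g = {z. chordal_deriv g z = 1}"

fun circle_inversion :: "complex \<Rightarrow> real \<Rightarrow> riemann_sphere \<Rightarrow> riemann_sphere" where
  "circle_inversion z0 r (Fin z) =
     (if z = z0 then Infty else Fin (z0 + of_real (r\<^sup>2) / (cnj z - cnj z0)))"
| "circle_inversion z0 r Infty = Fin z0"

(* Euclidean reflection in the line through p with direction v \<noteq> 0:
   twice the foot of the perpendicular from z, minus z. *)
fun line_reflection :: "complex \<Rightarrow> complex \<Rightarrow> riemann_sphere \<Rightarrow> riemann_sphere" where
  "line_reflection p v (Fin z) =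
     Fin (2 * (p + (((z - p) \<bullet> v) / (v \<bullet> v)) *\<^sub>R v) - z)"
| "line_reflection p v Infty = Infty"

definition is_reflection_across ::
    "riemann_sphere set \<Rightarrow> (riemann_sphere \<Rightarrow> riemann_sphere) \<Rightarrow> bool" where
  "is_reflection_across C R \<longleftrightarrow>
     (\<exists>z0 r. r > 0 \<and> C = Fin ` sphere z0 r \<and> R = circle_inversion z0 r) \<or>
     (\<exists>p v. v \<noteq> 0 \<and> C = insert Infty (Fin ` range (\<lambda>t. p + t *\<^sub>R v)) \<and> R = line_reflection p v)"

end

theory Submission
  imports Defs
begin

text \<open>
  In homogeneous coordinates the chordal distance is \<open>2 |x y' - x' y|\<close> divided by the two norms,
  so a map \<open>g\<close> of determinant one multiplies it by \<open>1 / sqrt (q z * q w)\<close>, where \<open>q\<close> is the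
  Hermitian form \<open>|a x + b y|\<^sup>2 + |c x + d y|\<^sup>2\<close> on unit vectors. As \<open>q\<close> is continuous, the chordal
  derivative is \<open>1 / q\<close>, and the chordal isometric circle \<open>q = 1\<close> is the zero set of the Hermitian
  form \<open>\<alpha> |z|\<^sup>2 - 2 Re (cnj p * z) + \<beta>\<close> with \<open>\<alpha> = 1 - |a|\<^sup>2 - |c|\<^sup>2\<close>, \<open>\<beta> = 1 - |b|\<^sup>2 - |d|\<^sup>2\<close> and
  \<open>p = cnj a * b + cnj c * d\<close>. The reflection in such a set is \<open>(p cnj z - \<beta>) / (\<alpha> cnj z - cnj p)\<close>,
  for circles and lines alike. Composing it with \<open>g\<close> gives a multiple of a unitary matrix,
  hence an isometry. By Lagrange's identity the discriminant \<open>|p|\<^sup>2 - \<alpha> \<beta>\<close> equals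
  \<open>|a|\<^sup>2 + |b|\<^sup>2 + |c|\<^sup>2 + |d|\<^sup>2 - 2\<close>, which vanishes only if \<open>g\<close> is itself unitary.
\<close>

section \<open>Homogeneous coordinates\<close>

text \<open>Homogeneous coordinates \<open>[x : y]\<close> of a point of the projective line. The
  pair \<open>(0, 0)\<close> is sent to \<open>Infty\<close> as a default, so the facts below demand
  a nonzero pair.\<close>

definition proj :: "complex \<Rightarrow> complex \<Rightarrow> riemann_sphere" where
  "proj x y = (if y = 0 then Infty else Fin (x / y))"

lemma Fin_eq_proj: "Fin z = proj z 1"
  and Infty_eq_proj: "Infty = proj 1 0"
  by (simp_all add: proj_def)

lemma proj_cases:
  obtains x y where "z = proj x y" "x \<noteq> 0 \<or> y \<noteq> 0"
  by (metis Fin_eq_proj Infty_eq_proj riemann_sphere.exhaust zero_neq_one)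

lemma dist_proj:
  assumes "x \<noteq> 0 \<or> y \<noteq> 0" "x' \<noteq> 0 \<or> y' \<noteq> 0"
  shows "dist (proj x y) (proj x' y') =
    2 * norm (x * y' - x' * y) /
      (sqrt ((norm x)\<^sup>2 + (norm y)\<^sup>2) * sqrt ((norm x')\<^sup>2 + (norm y')\<^sup>2))"
proof -
  have sq: "sqrt (1 + (norm u / norm v)\<^sup>2) = sqrt ((norm u)\<^sup>2 + (norm v)\<^sup>2) / norm v"
    if "v \<noteq> 0" for u v :: complex
  proof -
    have "1 + (norm u / norm v)\<^sup>2 = ((norm u)\<^sup>2 + (norm v)\<^sup>2) / (norm v)\<^sup>2"
      using that by (simp add: power_divide field_simps)
    then show ?thesis by (simp add: real_sqrt_divide)
  qed
  have df: "x / y - x' / y' = (x * y' - x' * y) / (y * y')" if "y \<noteq> 0" "y' \<noteq> 0"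
    using that by (simp add: field_simps)
  show ?thesis
    using assms
    by (cases "y = 0"; cases "y' = 0")
      (simp_all add: proj_def sq df norm_mult norm_divide norm_minus_commute)
qed

section \<open>Moebius maps as chordal similarities\<close>

lemma moebius_map_proj:
  assumes "a * d - b * c \<noteq> 0" "x \<noteq> 0 \<or> y \<noteq> 0"
  shows "moebius_map a b c d (proj x y) = proj (a * x + b * y) (c * x + d * y)"
    and "a * x + b * y \<noteq> 0 \<or> c * x + d * y \<noteq> 0"
proof -
  show nz: "a * x + b * y \<noteq> 0 \<or> c * x + d * y \<noteq> 0"
  proof (rule ccontr)
    assume *: "\<not> ?thesis"
    \<comment> \<open>Cramer's rule: a nonsingular matrix kills no nonzero vector.\<close>
    have "(a * d - b * c) * x = 0" "(a * d - b * c) * y = 0"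
      using * by algebra+
    with assms show False by auto
  qed
  show "moebius_map a b c d (proj x y) = proj (a * x + b * y) (c * x + d * y)"
  proof (cases "y = 0")
    case True
    then show ?thesis using assms by (simp add: proj_def)
  next
    case False
    have "c * (x / y) + d = (c * x + d * y) / y" "a * (x / y) + b = (a * x + b * y) / y"
      using False by (simp_all add: field_simps)
    then show ?thesis using False by (simp add: proj_def)
  qed
qed

text \<open>Acting on homogeneous coordinates turns composition into multiplication of matrices, and
  the product is nonsingular because determinants multiply.\<close>

lemma moebius_map_comp:
  assumes "a * d - b * c \<noteq> 0" "a' * d' - b' * c' \<noteq> 0"
  shows "moebius_map a b c d \<circ> moebius_map a' b' c' d' =
    moebius_map (a * a' + b * c') (a * b' + b * d') (c * a' + d * c') (c * b' + d * d')"
proof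
  fix z
  obtain x y where z: "z = proj x y" "x \<noteq> 0 \<or> y \<noteq> 0" by (rule proj_cases)
  have "(a * a' + b * c') * (c * b' + d * d') - (a * b' + b * d') * (c * a' + d * c')
      = (a * d - b * c) * (a' * d' - b' * c')"
    by (simp add: algebra_simps)
  then have nz: "(a * a' + b * c') * (c * b' + d * d') - (a * b' + b * d') * (c * a' + d * c') \<noteq> 0"
    using assms by (metis mult_eq_0_iff)
  have eqs: "(a * a' + b * c') * x + (a * b' + b * d') * y
      = a * (a' * x + b' * y) + b * (c' * x + d' * y)"
    "(c * a' + d * c') * x + (c * b' + d * d') * y
      = c * (a' * x + b' * y) + d * (c' * x + d' * y)"
    by (simp_all add: algebra_simps)
  show "(moebius_map a b c d \<circ> moebius_map a' b' c' d') z =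
    moebius_map (a * a' + b * c') (a * b' + b * d') (c * a' + d * c') (c * b' + d * d') z"
    unfolding z(1) comp_apply moebius_map_proj(1)[OF nz z(2)] moebius_map_proj(1)[OF assms(2) z(2)]
      moebius_map_proj(1)[OF assms(1) moebius_map_proj(2)[OF assms(2) z(2)]] eqs ..
qed

lemma moebius_map_scalar: "k \<noteq> 0 \<Longrightarrow> moebius_map k 0 0 k = id"
proof
  fix z assume "k \<noteq> 0" then show "moebius_map k 0 0 k z = id z" by (cases z) auto
qed

lemma surj_moebius_map:
  assumes "a * d - b * c \<noteq> 0"
  shows "surj (moebius_map a b c d)"
proof -
  \<comment> \<open>The adjugate matrix is a right inverse up to the scalar
    \<open>a * d - b * c\<close>.\<close>
  have inv: "d * a - (- b) * (- c) \<noteq> 0"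
    using assms by (simp add: mult.commute)
  have "a * d + b * (- c) = a * d - b * c" "a * (- b) + b * a = 0"
    "c * d + d * (- c) = 0" "c * (- b) + d * a = a * d - b * c"
    by (simp_all add: algebra_simps)
  then have "moebius_map a b c d \<circ> moebius_map d (- b) (- c) a = id"
    unfolding moebius_map_comp[OF assms inv] using moebius_map_scalar[OF assms] by (simp only:)
  then show ?thesis by (rule surjI[OF pointfree_idE])
qed

text \<open>The reciprocal of the chordal derivative of a map of determinant one.\<close>
fun scale :: "complex \<Rightarrow> complex \<Rightarrow> complex \<Rightarrow> complex \<Rightarrow> riemann_sphere \<Rightarrow> real" where
  "scale a b c d (Fin z) =
     ((norm (a * z + b))\<^sup>2 + (norm (c * z + d))\<^sup>2) / (1 + (norm z)\<^sup>2)"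
| "scale a b c d Infty = (norm a)\<^sup>2 + (norm c)\<^sup>2"

lemma scale_proj:
  assumes "x \<noteq> 0 \<or> y \<noteq> 0"
  shows "scale a b c d (proj x y) =
    ((norm (a * x + b * y))\<^sup>2 + (norm (c * x + d * y))\<^sup>2) / ((norm x)\<^sup>2 + (norm y)\<^sup>2)"
proof (cases "y = 0")
  case True
  then show ?thesis using assms
    by (simp add: proj_def norm_mult power_mult_distrib field_simps)
next
  case False
  have "a * (x / y) + b = (a * x + b * y) / y" "c * (x / y) + d = (c * x + d * y) / y"
    using False by (simp_all add: field_simps)
  moreover have "1 + (norm (x / y))\<^sup>2 = ((norm x)\<^sup>2 + (norm y)\<^sup>2) / (norm y)\<^sup>2"
    using False by (simp add: norm_divide power_divide field_simps)
  ultimately show ?thesis using False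
    by (simp add: proj_def norm_divide power_divide add_divide_distrib[symmetric])
qed

text \<open>The numerator in \<open>dist_proj\<close> is a 2 by 2 determinant, so it is multiplied
  by \<open>a * d - b * c\<close>; the two norms in the denominator change by the square roots of
  \<open>scale\<close>.\<close>

lemma dist_moebius_map:
  assumes "a * d - b * c \<noteq> 0"
  shows "dist (moebius_map a b c d z) (moebius_map a b c d w) =
    norm (a * d - b * c) * dist z w / sqrt (scale a b c d z * scale a b c d w)"
proof -
  obtain x y where z: "z = proj x y" "x \<noteq> 0 \<or> y \<noteq> 0" by (rule proj_cases)
  obtain x' y' where w: "w = proj x' y'" "x' \<noteq> 0 \<or> y' \<noteq> 0" by (rule proj_cases)
  have pos: "sqrt ((norm x)\<^sup>2 + (norm y)\<^sup>2) \<noteq> 0" "sqrt ((norm x')\<^sup>2 + (norm y')\<^sup>2) \<noteq> 0"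
    using z(2) w(2) by (simp_all add: add_nonneg_eq_0_iff)
  have "(a * x + b * y) * (c * x' + d * y') - (a * x' + b * y') * (c * x + d * y)
      = (a * d - b * c) * (x * y' - x' * y)"
    by algebra
  then show ?thesis
    unfolding z(1) w(1) scale_proj[OF z(2)] scale_proj[OF w(2)]
      moebius_map_proj(1)[OF assms z(2)] moebius_map_proj(1)[OF assms w(2)]
      dist_proj[OF z(2) w(2)]
      dist_proj[OF moebius_map_proj(2)[OF assms z(2)] moebius_map_proj(2)[OF assms w(2)]]
    using pos by (simp add: norm_mult real_sqrt_mult real_sqrt_divide)
qed

lemma scale_pos:
  assumes "a * d - b * c \<noteq> 0"
  shows "scale a b c d z > 0"
proof -
  obtain x y where z: "z = proj x y" "x \<noteq> 0 \<or> y \<noteq> 0" by (rule proj_cases)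
  have "(norm u)\<^sup>2 + (norm v)\<^sup>2 > 0" if "u \<noteq> 0 \<or> v \<noteq> 0" for u v :: complex
    using that by (auto simp: add_pos_nonneg add_nonneg_pos)
  then show ?thesis
    using z moebius_map_proj(2)[OF assms z(2)] by (simp add: scale_proj)
qed

lemma chordal_isometry_moebius_map:
  assumes "a * d - b * c \<noteq> 0" "\<And>z. scale a b c d z = norm (a * d - b * c)"
  shows "chordal_isometry (moebius_map a b c d)"
  using assms by (simp add: chordal_isometry_def surj_moebius_map dist_moebius_map)

section \<open>The chordal derivative\<close>

lemma dist_stereo: "dist (stereo x) (stereo y) = dist x y"
proof -
  have pos: "1 + (norm z)\<^sup>2 > 0" for z :: complex
    by (simp add: add_pos_nonneg)
  have unit: "stereo x \<bullet> stereo x = 1" for x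
  proof (cases x)
    case (Fin z)
    define p where "p = 1 + (norm z)\<^sup>2"
    have p: "z \<bullet> z = p - 1" "p \<noteq> 0"
      using pos[of z] by (simp_all add: p_def power2_norm_eq_inner)
    have st: "stereo (Fin z) = ((2 / p) *\<^sub>R z, (p - 2) / p)" by (simp add: p_def)
    have "stereo x \<bullet> stereo x = 4 * (p - 1) / (p * p) + (p - 2) * (p - 2) / (p * p)"
      unfolding Fin st by (simp add: inner_prod_def p(1))
    also have "\<dots> = 1" using p(2) by (simp add: field_simps)
    finally show ?thesis .
  qed (simp add: inner_prod_def)
  \<comment> \<open>For unit vectors the squared distance is 2 minus twice the inner product, so it
    suffices to compute inner products.\<close>
  have ip: "2 - 2 * (stereo x \<bullet> stereo y) = (dist x y)\<^sup>2" for x y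
  proof (cases x; cases y)
    fix z w assume xy: "x = Fin z" "y = Fin w"
    define p q where "p = 1 + (norm z)\<^sup>2" and "q = 1 + (norm w)\<^sup>2"
    have pq: "p > 0" "q > 0" using pos by (simp_all add: p_def q_def)
    have nz: "(norm z)\<^sup>2 = p - 1" "(norm w)\<^sup>2 = q - 1" by (simp_all add: p_def q_def)
    have "(norm (z - w))\<^sup>2 = (p - 1) + (q - 1) - 2 * (z \<bullet> w)"
      by (simp add: p_def q_def power2_norm_eq_inner inner_diff inner_commute)
    then show ?thesis
      using pq by (simp add: xy inner_prod_def nz power_divide power_mult_distrib field_simps)
  next
    fix z assume xy: "x = Fin z" "y = Infty"
    show ?thesis using pos[of z] by (simp add: xy inner_prod_def power_divide field_simps)
  next
    fix z assume xy: "x = Infty" "y = Fin z"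
    show ?thesis using pos[of z] by (simp add: xy inner_prod_def power_divide field_simps)
  qed (simp add: inner_prod_def)
  have "(dist (stereo x) (stereo y))\<^sup>2 = (dist x y)\<^sup>2"
    using ip[of x y] unit[of x] unit[of y]
    by (simp add: dist_norm power2_norm_eq_inner inner_diff inner_commute)
  then show ?thesis by simp
qed

lemma continuous_on_stereo: "continuous_on UNIV stereo"
  unfolding continuous_on_iff dist_stereo by blast

lemma power2_norm_linear_form:
  "(norm (a * z + b))\<^sup>2 =
    (norm a)\<^sup>2 * (norm z)\<^sup>2 + 2 * Re (a * cnj b * z) + (norm (b :: complex))\<^sup>2"
  by (simp only: cmod_power2) (simp add: power2_eq_square algebra_simps)

text \<open>A Hermitian form restricted to unit vectors is an affine function on the Riemann sphere
  embedded in three-space.\<close>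
lemma scale_stereo:
  "scale a b c d z =
    ((norm a)\<^sup>2 + (norm c)\<^sup>2) * ((1 + snd (stereo z)) / 2) +
    ((norm b)\<^sup>2 + (norm d)\<^sup>2) * ((1 - snd (stereo z)) / 2) +
    Re ((a * cnj b + c * cnj d) * fst (stereo z))"
proof (cases z)
  case (Fin u)
  define p where "p = 1 + (norm u)\<^sup>2"
  have p: "(norm u)\<^sup>2 = p - 1" "p \<noteq> 0"
    using add_pos_nonneg[of 1 "(norm u)\<^sup>2"] by (simp_all add: p_def)
  have "(a * cnj b + c * cnj d) * ((2 / p) *\<^sub>R u) = (2 / p) *\<^sub>R (a * cnj b * u + c * cnj d * u)"
    by (simp add: algebra_simps)
  then have re: "Re ((a * cnj b + c * cnj d) * ((2 / p) *\<^sub>R u))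
      = 2 / p * (Re (a * cnj b * u) + Re (c * cnj d * u))"
    by (simp only: scaleR_complex.sel plus_complex.sel)
  have st: "stereo (Fin u) = ((2 / p) *\<^sub>R u, (p - 2) / p)"
    by (simp add: p_def)
  have sc: "scale a b c d (Fin u) = ((norm (a * u + b))\<^sup>2 + (norm (c * u + d))\<^sup>2) / p"
    by (simp add: p_def)
  show ?thesis
    unfolding Fin st sc fst_conv snd_conv re power2_norm_linear_form p(1)
    using p(2) by (simp add: field_simps)
qed simp

lemma continuous_on_scale: "continuous_on UNIV (scale a b c d)"
  unfolding scale_stereo
  by (intro continuous_intros continuous_on_stereo) auto

text \<open>The sphere has no isolated points. This makes the limit unique, so that
  \<open>Lim\<close> in \<open>chordal_deriv\<close> can be evaluated.\<close>

lemma at_riemann_sphere_neq_bot: "at (z :: riemann_sphere) \<noteq> bot"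
proof -
  have "\<exists>w. w \<noteq> z \<and> dist w z < e" if e: "e > 0" for e
  proof (cases z)
    case (Fin u)
    \<comment> \<open>Both square roots in the denominator are at least 1, so a shift by
      \<open>e / 4\<close> costs at most \<open>e / 2\<close>.\<close>
    have "dist (Fin (u + of_real (e / 4))) (Fin u) \<le> 2 * (e / 4) / (1 * 1)"
      unfolding dist_riemann_sphere.simps using e
      by (intro frac_le mult_mono) auto
    then show ?thesis
      using e Fin by (intro exI[of _ "Fin (u + of_real (e / 4))"]) auto
  next
    case Infty
    have "sqrt (1 + (4 / e)\<^sup>2) \<ge> 4 / e"
      by (intro real_le_rsqrt) auto
    then have "2 / sqrt (1 + (4 / e)\<^sup>2) \<le> 2 / (4 / e)"
      using e by (intro divide_left_mono mult_pos_pos) (auto simp: add_pos_nonneg)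
    then have "dist (Fin (of_real (4 / e))) Infty < e"
      using e by (simp add: norm_divide)
    then show ?thesis
      using Infty by (intro exI[of _ "Fin (of_real (4 / e))"]) auto
  qed
  then have "z islimpt UNIV" by (auto simp: islimpt_approachable)
  then show ?thesis by (simp add: trivial_limit_within)
qed

lemma chordal_deriv_moebius_map:
  assumes "a * d - b * c = 1"
  shows "chordal_deriv (moebius_map a b c d) z = 1 / scale a b c d z"
proof -
  let ?g = "moebius_map a b c d" and ?q = "scale a b c d"
  have pos: "?q w > 0" for w using assms by (simp add: scale_pos)
  have "isCont ?q z" using continuous_on_scale by (simp add: continuous_on_eq_continuous_at)
  then have "(?q \<longlongrightarrow> ?q z) (at z)" by (simp add: isCont_def)
  then have "((\<lambda>w. 1 / sqrt (?q w * ?q z)) \<longlongrightarrow> 1 / sqrt (?q z * ?q z)) (at z)"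
    using pos[of z] by (intro tendsto_intros) auto
  then have "((\<lambda>w. 1 / sqrt (?q w * ?q z)) \<longlongrightarrow> 1 / ?q z) (at z)"
    using pos[of z] by simp
  \<comment> \<open>The equality concerns \<open>w\<close> different from \<open>z\<close>; at
    \<open>w = z\<close> the quotient has the default value 0.\<close>
  moreover have "\<forall>\<^sub>F w in at z. 1 / sqrt (?q w * ?q z) = dist (?g w) (?g z) / dist w z"
    using assms by (auto simp: eventually_at_filter dist_moebius_map)
  ultimately have "((\<lambda>w. dist (?g w) (?g z) / dist w z) \<longlongrightarrow> 1 / ?q z) (at z)"
    by (rule Lim_transform_eventually)
  then show ?thesis
    unfolding chordal_deriv_def by (rule tendsto_Lim[OF at_riemann_sphere_neq_bot])
qed

lemma mem_chordal_isometric_circle: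
  assumes "a * d - b * c = 1"
  shows "z \<in> chordal_isometric_circle (moebius_map a b c d) \<longleftrightarrow> scale a b c d z = 1"
  using scale_pos[of a d b c z] assms
  by (simp add: chordal_isometric_circle_def chordal_deriv_moebius_map)

section \<open>Reflections in generalized circles\<close>

text \<open>The zero set of the form \<alpha> |x|^2 - 2 Re (cnj p * x * cnj y) + \<beta> |y|^2 on
  points \<open>[x : y]\<close>. Its value at \<open>Infty\<close>, that is at
  \<open>[1 : 0]\<close>, is \<alpha>, which explains the case distinction.\<close>

definition gcircle :: "real \<Rightarrow> complex \<Rightarrow> real \<Rightarrow> riemann_sphere set" where
  "gcircle \<alpha> p \<beta> =
     Fin ` {z. \<alpha> * (norm z)\<^sup>2 - 2 * Re (cnj p * z) + \<beta> = 0} \<union> (if \<alpha> = 0 then {Infty} else {})"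

text \<open>Obtained by polarization: the image \<open>w\<close> of \<open>z\<close> solves \<alpha>
  w cnj z - cnj p * w - p * cnj z + \<beta> = 0, which on the diagonal \<open>w = z\<close> is the
  equation of the circle.\<close>

definition greflection :: "real \<Rightarrow> complex \<Rightarrow> real \<Rightarrow> riemann_sphere \<Rightarrow> riemann_sphere" where
  "greflection \<alpha> p \<beta> = anti_moebius_map p (- of_real \<beta>) (of_real \<alpha>) (- cnj p)"

lemma of_real_norm_power2: "(complex_of_real (norm z))\<^sup>2 = z * cnj z"
  using complex_norm_square[of z] by simp

text \<open>Multiply the equation by \<alpha> and complete the square.\<close>

lemma gcircle_eq_sphere:
  assumes "\<alpha> \<noteq> 0" "(norm p)\<^sup>2 - \<alpha> * \<beta> > 0"
  shows "gcircle \<alpha> p \<beta> = Fin ` sphere (p / of_real \<alpha>) (sqrt ((norm p)\<^sup>2 - \<alpha> * \<beta>) / \<bar>\<alpha>\<bar>)"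
proof -
  have "z \<in> sphere (p / of_real \<alpha>) (sqrt ((norm p)\<^sup>2 - \<alpha> * \<beta>) / \<bar>\<alpha>\<bar>) \<longleftrightarrow>
      \<alpha> * (norm z)\<^sup>2 - 2 * Re (cnj p * z) + \<beta> = 0" for z
  proof -
    have "p / of_real \<alpha> - z = (p - of_real \<alpha> * z) / of_real \<alpha>"
      using assms(1) by (simp add: field_simps)
    then have "norm (p / of_real \<alpha> - z) = norm (p - of_real \<alpha> * z) / \<bar>\<alpha>\<bar>"
      by (simp add: norm_divide)
    then have "z \<in> sphere (p / of_real \<alpha>) (sqrt ((norm p)\<^sup>2 - \<alpha> * \<beta>) / \<bar>\<alpha>\<bar>) \<longleftrightarrow>
        norm (p - of_real \<alpha> * z) = sqrt ((norm p)\<^sup>2 - \<alpha> * \<beta>)"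
      using assms(1) by (simp add: dist_norm)
    also have "\<dots> \<longleftrightarrow> (norm (p - of_real \<alpha> * z))\<^sup>2 = (norm p)\<^sup>2 - \<alpha> * \<beta>"
      using assms(2)
      by (metis norm_ge_zero real_sqrt_pow2 real_sqrt_unique less_imp_le)
    also have "(norm (p - of_real \<alpha> * z))\<^sup>2 =
        (norm p)\<^sup>2 - \<alpha> * \<beta> + \<alpha> * (\<alpha> * (norm z)\<^sup>2 - 2 * Re (cnj p * z) + \<beta>)"
      by (simp only: cmod_power2) (simp add: power2_eq_square algebra_simps)
    finally show ?thesis using assms(1) by simp
  qed
  then show ?thesis unfolding gcircle_def using assms(1) by auto
qed

lemma gcircle_eq_line:
  "gcircle 0 p \<beta> = insert Infty (Fin ` {z. 2 * Re (cnj p * z) = \<beta>})"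
  by (auto simp: gcircle_def)

lemma circle_inversion_eq_greflection:
  assumes "\<alpha> \<noteq> 0" "(norm p)\<^sup>2 - \<alpha> * \<beta> > 0"
  shows "circle_inversion (p / of_real \<alpha>) (sqrt ((norm p)\<^sup>2 - \<alpha> * \<beta>) / \<bar>\<alpha>\<bar>) =
    greflection \<alpha> p \<beta>"
proof
  let ?\<alpha> = "complex_of_real \<alpha>" and ?\<beta> = "complex_of_real \<beta>"
  have r2: "complex_of_real ((sqrt ((norm p)\<^sup>2 - \<alpha> * \<beta>) / \<bar>\<alpha>\<bar>)\<^sup>2) = (p * cnj p - ?\<alpha> * ?\<beta>) / ?\<alpha>\<^sup>2"
    using assms by (simp add: power_divide of_real_norm_power2)
  fix z
  show "circle_inversion (p / of_real \<alpha>) (sqrt ((norm p)\<^sup>2 - \<alpha> * \<beta>) / \<bar>\<alpha>\<bar>) z =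
    greflection \<alpha> p \<beta> z"
  proof (cases z)
    case Infty
    then show ?thesis using assms(1) by (simp add: greflection_def anti_moebius_map_def)
  next
    case (Fin u)
    \<comment> \<open>\<open>q\<close> is the denominator of the reflection. It vanishes exactly at
      the centre, where both maps give \<open>Infty\<close>; elsewhere both sides become rational
      functions of \<open>q\<close>.\<close>
    define q where "q = ?\<alpha> * cnj u - cnj p"
    have q: "cnj u = (q + cnj p) / ?\<alpha>" using assms(1) by (simp add: q_def)
    have "cnj q = ?\<alpha> * u - p" by (simp add: q_def)
    then have "u = p / ?\<alpha> \<longleftrightarrow> cnj q = 0" using assms(1) by (auto simp: field_simps)
    then have u: "u = p / ?\<alpha> \<longleftrightarrow> q = 0" by simp
    have "p / ?\<alpha> + (p * cnj p - ?\<alpha> * ?\<beta>) / ?\<alpha>\<^sup>2 / (cnj u - cnj (p / ?\<alpha>))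
        = (p * cnj u + - ?\<beta>) / q" if "q \<noteq> 0"
    proof -
      have "cnj u - cnj (p / ?\<alpha>) = q / ?\<alpha>" using assms(1) by (simp add: q field_simps)
      then show ?thesis using assms(1) that unfolding q
        by (simp add: field_simps power2_eq_square)
    qed
    moreover have "?\<alpha> * cnj u + - cnj p = q" by (simp add: q_def)
    ultimately show ?thesis
      unfolding Fin greflection_def anti_moebius_map_def circle_inversion.simps
        cnj_sphere.simps moebius_map.simps u r2 by simp
  qed
qed

text \<open>The hypotheses say that \<open>v\<close> is orthogonal to the normal \<open>p\<close>
  and that \<open>s\<close> lies on the line. The reflection sends \<open>u\<close> to
  \<open>s + v / cnj v * cnj (u - s)\<close>, and orthogonality turns \<open>v / cnj v\<close> into
  \<open>- p / cnj p\<close>.\<close>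

lemma line_reflection_eq_greflection:
  assumes "v \<noteq> 0" "p \<noteq> 0" "Re (cnj p * v) = 0" "2 * Re (cnj p * s) = \<beta>"
  shows "line_reflection s v = greflection 0 p \<beta>"
proof
  fix z
  show "line_reflection s v z = greflection 0 p \<beta> z"
  proof (cases z)
    case Infty
    then show ?thesis by (simp add: greflection_def anti_moebius_map_def)
  next
    case (Fin u)
    let ?w = "u - s"
    have pv: "cnj p * v + p * cnj v = 0"
      using assms(3) by (simp add: complex_eq_iff)
    have ps: "cnj p * s + p * cnj s = of_real \<beta>"
      using assms(4) by (simp add: complex_eq_iff)
    have ip: "complex_of_real (x \<bullet> y) = (x * cnj y + cnj x * y) / 2" for x y
      by (simp add: complex_eq_iff inner_complex_def)
    have "2 * (s + ((?w \<bullet> v) / (v \<bullet> v)) *\<^sub>R v) - u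
        = 2 * (s + (?w * cnj v + cnj ?w * v) / (v * cnj v + cnj v * v) * v) - u"
      by (simp add: scaleR_conv_of_real ip)
    also have "\<dots> = s + v / cnj v * cnj ?w"
      using assms(1) by (simp add: field_simps)
    also have "v / cnj v = - p / cnj p"
    proof -
      have "cnj p * v = - p * cnj v" using pv by (simp add: add_eq_0_iff2)
      then show ?thesis using assms(1,2) by (simp add: field_simps)
    qed
    also have "s + - p / cnj p * cnj ?w = (p * cnj u + - of_real \<beta>) / (- cnj p)"
      using assms(2) unfolding ps[symmetric] by (simp add: field_simps)
    finally show ?thesis
      using assms(2) by (simp add: Fin greflection_def anti_moebius_map_def)
  qed
qed

text \<open>Four points of the first circle suffice: those in the directions 1, -1,
  \<open>\<i>\<close> and \<open>- \<i>\<close> from \<open>x\<close>. Subtracting the equations of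
  opposite points gives equal centres.\<close>

lemma sphere_complex_inject:
  fixes x y :: complex
  assumes "r > 0" "s > 0" "sphere x r = sphere y s"
  shows "x = y" "r = s"
proof -
  have on: "(Re (x - y) + r * Re u)\<^sup>2 + (Im (x - y) + r * Im u)\<^sup>2 = s\<^sup>2" if "norm u = 1" for u
  proof -
    have "x + of_real r * u \<in> sphere x r" using that assms(1) by (simp add: dist_norm norm_mult)
    then have "norm (x + of_real r * u - y) = s"
      unfolding assms(3) by (simp add: dist_norm norm_minus_commute)
    then have "s\<^sup>2 = (norm (x + of_real r * u - y))\<^sup>2" by simp
    also have "\<dots> = (Re (x - y) + r * Re u)\<^sup>2 + (Im (x - y) + r * Im u)\<^sup>2"
      by (simp only: cmod_power2) (simp add: algebra_simps)
    finally show ?thesis ..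
  qed
  define m n where "m = Re (x - y)" and "n = Im (x - y)"
  have "(m + r)\<^sup>2 + n\<^sup>2 = s\<^sup>2" "(m - r)\<^sup>2 + n\<^sup>2 = s\<^sup>2"
    "m\<^sup>2 + (n + r)\<^sup>2 = s\<^sup>2" "m\<^sup>2 + (n - r)\<^sup>2 = s\<^sup>2"
    using on[of 1] on[of "-1"] on[of \<i>] on[of "- \<i>"]
    unfolding m_def[symmetric] n_def[symmetric] by simp_all
  then have "(m + r)\<^sup>2 = (m - r)\<^sup>2" "(n + r)\<^sup>2 = (n - r)\<^sup>2" by linarith+
  then have "m = 0" "n = 0"
    using assms(1) by (simp_all add: power2_eq_square algebra_simps)
  then show xy: "x = y" by (simp add: complex_eq_iff m_def n_def)
  show "r = s" using on[of 1] assms(1,2) by (simp add: xy)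
qed

lemma is_reflection_across_greflection:
  assumes "(norm p)\<^sup>2 - \<alpha> * \<beta> > 0"
  shows "is_reflection_across (gcircle \<alpha> p \<beta>) (greflection \<alpha> p \<beta>)"
proof (cases "\<alpha> = 0")
  case False
  then show ?thesis unfolding is_reflection_across_def
    using gcircle_eq_sphere[OF False assms] circle_inversion_eq_greflection[OF False assms] assms
    by (intro disjI1 exI[of _ "p / of_real \<alpha>"] exI[of _ "sqrt ((norm p)\<^sup>2 - \<alpha> * \<beta>) / \<bar>\<alpha>\<bar>"]) simp
next
  case True
  with assms have p: "p \<noteq> 0" by auto
  \<comment> \<open>The foot of the perpendicular from 0 to the line; \<open>\<i> * p\<close> is
    orthogonal to the normal \<open>p\<close> and serves as direction.\<close>
  define s where "s = of_real (\<beta> / 2) / cnj p"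
  have s: "cnj p * s = of_real (\<beta> / 2)" using p by (simp add: s_def)
  have "{z. 2 * Re (cnj p * z) = \<beta>} = range (\<lambda>t. s + t *\<^sub>R (\<i> * p))"
  proof (intro set_eqI iffI)
    fix z assume "z \<in> {z. 2 * Re (cnj p * z) = \<beta>}"
    \<comment> \<open>The equation of the line fixes the real part of \<open>cnj p * z\<close>; its
      imaginary part supplies the parameter.\<close>
    then have "cnj p * z = of_real (\<beta> / 2) + of_real (Im (cnj p * z)) * \<i>"
      by (simp add: complex_eq_iff)
    also have "\<dots> = cnj p * (s + (Im (cnj p * z) / (norm p)\<^sup>2) *\<^sub>R (\<i> * p))"
      using p unfolding distrib_left s
      by (simp add: scaleR_conv_of_real of_real_norm_power2 field_simps)
    finally show "z \<in> range (\<lambda>t. s + t *\<^sub>R (\<i> * p))"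
      using p by (metis mult_cancel_left complex_cnj_zero_iff rangeI)
  next
    fix z assume "z \<in> range (\<lambda>t. s + t *\<^sub>R (\<i> * p))"
    then obtain t where "z = s + t *\<^sub>R (\<i> * p)" by auto
    then have "cnj p * z = of_real (\<beta> / 2) + cnj p * (t *\<^sub>R (\<i> * p))"
      by (simp only: distrib_left s)
    then have "Re (cnj p * z) = Re (of_real (\<beta> / 2) + cnj p * (t *\<^sub>R (\<i> * p)))"
      by (rule arg_cong)
    then show "z \<in> {z. 2 * Re (cnj p * z) = \<beta>}" by simp
  qed
  moreover have "2 * Re (cnj p * s) = \<beta>" unfolding s by simp
  then have "line_reflection s (\<i> * p) = greflection 0 p \<beta>"
    by (intro line_reflection_eq_greflection) (use p in auto)
  moreover have "\<i> * p \<noteq> 0" using p by simp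
  ultimately show ?thesis
    unfolding is_reflection_across_def True gcircle_eq_line by metis
qed

text \<open>Membership of \<open>Infty\<close> separates circles from lines. A circle determines its
  centre and radius. A line has many pairs of base point and direction, but each satisfies the
  hypotheses of \<open>line_reflection_eq_greflection\<close>.\<close>

lemma is_reflection_across_gcircle_unique:
  assumes "(norm p)\<^sup>2 - \<alpha> * \<beta> > 0" "is_reflection_across (gcircle \<alpha> p \<beta>) R"
  shows "R = greflection \<alpha> p \<beta>"
  using assms(2) unfolding is_reflection_across_def
proof (elim disjE exE conjE)
  fix z0 r
  assume R: "r > 0" "gcircle \<alpha> p \<beta> = Fin ` sphere z0 r" "R = circle_inversion z0 r"
  have \<alpha>: "\<alpha> \<noteq> 0"
  proof
    assume "\<alpha> = 0"
    then have "Infty \<in> Fin ` sphere z0 r" by (simp flip: R(2) add: gcircle_def)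
    then show False by auto
  qed
  let ?r = "sqrt ((norm p)\<^sup>2 - \<alpha> * \<beta>) / \<bar>\<alpha>\<bar>"
  have "Fin ` sphere z0 r = Fin ` sphere (p / of_real \<alpha>) ?r"
    using R(2) gcircle_eq_sphere[OF \<alpha> assms(1)] by simp
  then have eq: "sphere z0 r = sphere (p / of_real \<alpha>) ?r"
    by (subst (asm) inj_image_eq_iff) (auto intro: injI)
  have "?r > 0" using \<alpha> assms(1) by simp
  from sphere_complex_inject[OF R(1) this eq] show ?thesis
    using R(3) circle_inversion_eq_greflection[OF \<alpha> assms(1)] by simp
next
  fix s v
  assume R: "v \<noteq> 0" "gcircle \<alpha> p \<beta> = insert Infty (Fin ` range (\<lambda>t. s + t *\<^sub>R v))"
    "R = line_reflection s v"
  have "Infty \<in> gcircle \<alpha> p \<beta>" by (simp add: R(2))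
  then have \<alpha>: "\<alpha> = 0" by (auto simp: gcircle_def split: if_splits)
  with assms(1) have p: "p \<noteq> 0" by auto
  have on: "2 * Re (cnj p * (s + t *\<^sub>R v)) = \<beta>" for t
  proof -
    have "Fin (s + t *\<^sub>R v) \<in> gcircle \<alpha> p \<beta>" unfolding R(2) by blast
    then show ?thesis by (auto simp: \<alpha> gcircle_eq_line)
  qed
  have "2 * Re (cnj p * s) = \<beta>" using on[of 0] by simp
  moreover have "Re (cnj p * v) = 0" using on[of 0] on[of 1] by (simp add: distrib_left)
  ultimately show ?thesis
    using line_reflection_eq_greflection[OF R(1) p] R(3) \<alpha> by simp
qed

section \<open>Conjugation, anti-Moebius isometries and involutions\<close>

lemma cnj_sphere_moebius_map:
  "cnj_sphere (moebius_map a b c d z) = moebius_map (cnj a) (cnj b) (cnj c) (cnj d) (cnj_sphere z)"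
proof (cases z)
  case (Fin u)
  have "cnj c * cnj u + cnj d = 0 \<longleftrightarrow> c * u + d = 0"
    by (metis complex_cnj_add complex_cnj_mult complex_cnj_zero_iff)
  then show ?thesis by (simp add: Fin)
qed simp

lemma cnj_sphere_cnj_sphere [simp]: "cnj_sphere (cnj_sphere z) = z"
  by (cases z) auto

lemma dist_cnj_sphere: "dist (cnj_sphere z) (cnj_sphere w) = dist z w"
proof -
  have "norm (cnj u - cnj v) = norm (u - v)" for u v
    by (metis complex_cnj_diff complex_mod_cnj)
  then show ?thesis by (cases z; cases w) auto
qed

lemma chordal_isometry_anti_moebius_map:
  assumes "chordal_isometry (moebius_map a b c d)"
  shows "chordal_isometry (anti_moebius_map a b c d)"
proof -
  have "surj (moebius_map a b c d \<circ> cnj_sphere)"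
    using assms by (intro comp_surj surjI[of cnj_sphere cnj_sphere]) (auto simp: chordal_isometry_def)
  then show ?thesis using assms
    by (simp add: chordal_isometry_def anti_moebius_map_def comp_def dist_cnj_sphere)
qed

text \<open>Moving the inner conjugation outward, the square has as matrix the reflection matrix
  times its entrywise conjugate, which is the scalar |p|^2 - \<alpha> \<beta>.\<close>

lemma greflection_involution:
  assumes "(norm p)\<^sup>2 - \<alpha> * \<beta> > 0"
  shows "greflection \<alpha> p \<beta> \<circ> greflection \<alpha> p \<beta> = id"
proof -
  let ?\<alpha> = "complex_of_real \<alpha>" and ?\<beta> = "complex_of_real \<beta>"
  define k where "k = p * cnj p - ?\<alpha> * ?\<beta>"
  have "k = of_real ((norm p)\<^sup>2 - \<alpha> * \<beta>)" by (simp add: k_def of_real_norm_power2)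
  then have k: "k \<noteq> 0" using assms by (metis of_real_eq_0_iff less_irrefl)
  have "p * (- cnj p) - (- ?\<beta>) * ?\<alpha> = - k" "cnj p * (- p) - (- ?\<beta>) * ?\<alpha> = - k"
    by (simp_all add: k_def)
  then have det: "p * (- cnj p) - (- ?\<beta>) * ?\<alpha> \<noteq> 0" "cnj p * (- p) - (- ?\<beta>) * ?\<alpha> \<noteq> 0"
    using k by simp_all
  have "greflection \<alpha> p \<beta> \<circ> greflection \<alpha> p \<beta> =
      moebius_map p (- ?\<beta>) ?\<alpha> (- cnj p) \<circ> moebius_map (cnj p) (- ?\<beta>) ?\<alpha> (- p)"
    by (simp add: fun_eq_iff greflection_def anti_moebius_map_def cnj_sphere_moebius_map)
  also have "\<dots> = moebius_map k 0 0 k"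
  proof -
    have "p * cnj p + - ?\<beta> * ?\<alpha> = k" "p * - ?\<beta> + - ?\<beta> * - p = 0"
      "?\<alpha> * cnj p + - cnj p * ?\<alpha> = 0" "?\<alpha> * - ?\<beta> + - cnj p * - p = k"
      by (simp_all add: k_def)
    then show ?thesis unfolding moebius_map_comp[OF det] by (simp only:)
  qed
  also have "\<dots> = id" by (rule moebius_map_scalar[OF k])
  finally show ?thesis .
qed

section \<open>Decomposition of a Moebius map\<close>

text \<open>The Gram determinant of the columns \<open>(a, c)\<close> and \<open>(b, d)\<close> is
  the squared modulus of their determinant.\<close>

lemma complex_lagrange_identity:
  "((norm a)\<^sup>2 + (norm c)\<^sup>2) * ((norm b)\<^sup>2 + (norm d)\<^sup>2) =
    (norm (cnj a * b + cnj c * d))\<^sup>2 + (norm (a * d - b * c :: complex))\<^sup>2"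
  by (simp only: cmod_power2) (simp add: power2_eq_square algebra_simps)

lemma det_one_discriminant:
  assumes "a * d - b * c = (1 :: complex)"
  shows "(norm (cnj a * b + cnj c * d))\<^sup>2 -
      (1 - ((norm a)\<^sup>2 + (norm c)\<^sup>2)) * (1 - ((norm b)\<^sup>2 + (norm d)\<^sup>2)) =
    (norm a)\<^sup>2 + (norm b)\<^sup>2 + (norm c)\<^sup>2 + (norm d)\<^sup>2 - 2"
  using complex_lagrange_identity[of a c b d] assms by (simp add: algebra_simps)

text \<open>With \<open>A\<close>, \<open>B\<close> the squared column norms and \<open>p\<close>
  the inner product of the columns, Lagrange's identity gives A B = |p|^2 + 1. If A + B were at most
  2, then (A - B)^2 + 4 |p|^2 = (A + B)^2 - 4 would be at most 0; hence A = B = 1 and p = 0, and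
  \<open>scale\<close> is constantly 1.\<close>

lemma not_chordal_isometry_imp:
  assumes "a * d - b * c = 1" "\<not> chordal_isometry (moebius_map a b c d)"
  shows "(norm a)\<^sup>2 + (norm b)\<^sup>2 + (norm c)\<^sup>2 + (norm d)\<^sup>2 - 2 > 0"
proof (rule ccontr)
  define A B p where "A = (norm a)\<^sup>2 + (norm c)\<^sup>2" and "B = (norm b)\<^sup>2 + (norm d)\<^sup>2"
    and "p = a * cnj b + c * cnj d"
  assume "\<not> ?thesis"
  then have AB: "A + B \<le> 2" by (simp add: A_def B_def)
  have np: "norm (cnj a * b + cnj c * d) = norm p"
    unfolding p_def by (subst complex_mod_cnj[symmetric]) simp
  have prod: "A * B = (norm p)\<^sup>2 + 1"
    using complex_lagrange_identity[of a c b d] assms(1) by (simp add: A_def B_def np)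
  have "A \<ge> 0" "B \<ge> 0" by (simp_all add: A_def B_def)
  then have "(A + B)\<^sup>2 \<le> 2\<^sup>2" using AB by (intro power_mono) auto
  then have "(A - B)\<^sup>2 + 4 * (norm p)\<^sup>2 \<le> 0"
    using prod by (simp add: power2_eq_square algebra_simps)
  then have "A = B" "p = 0"
    by (simp_all add: sum_power2_le_zero_iff add_nonneg_eq_0_iff order_antisym_conv)
  moreover from this prod \<open>A \<ge> 0\<close> have "A = 1" by (simp add: square_eq_1_iff)
  ultimately have "scale a b c d z = 1" for z
    unfolding scale_stereo A_def[symmetric] B_def[symmetric] p_def[symmetric]
    by (simp add: add_divide_distrib[symmetric])
  then have "chordal_isometry (moebius_map a b c d)"
    using assms(1) by (intro chordal_isometry_moebius_map) simp_all
  with assms(2) show False by simp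
qed

text \<open>Expanding the squared norms in \<open>scale a b c d z = 1\<close> and collecting terms
  gives the three coefficients; at \<open>Infty\<close> the condition reads |a|^2 + |c|^2 =
  1.\<close>

lemma chordal_isometric_circle_moebius_map:
  assumes "a * d - b * c = 1"
  shows "chordal_isometric_circle (moebius_map a b c d) =
    gcircle (1 - ((norm a)\<^sup>2 + (norm c)\<^sup>2)) (cnj a * b + cnj c * d) (1 - ((norm b)\<^sup>2 + (norm d)\<^sup>2))"
proof (intro set_eqI)
  fix z
  show "z \<in> chordal_isometric_circle (moebius_map a b c d) \<longleftrightarrow> z \<in>
    gcircle (1 - ((norm a)\<^sup>2 + (norm c)\<^sup>2)) (cnj a * b + cnj c * d) (1 - ((norm b)\<^sup>2 + (norm d)\<^sup>2))"
  proof (cases z)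
    case (Fin u)
    have "1 + (norm u)\<^sup>2 > 0" by (simp add: add_pos_nonneg)
    then have "scale a b c d z = 1 \<longleftrightarrow>
        (norm (a * u + b))\<^sup>2 + (norm (c * u + d))\<^sup>2 = 1 + (norm u)\<^sup>2"
      by (auto simp: Fin)
    moreover have "cnj (cnj a * b + cnj c * d) * u = a * cnj b * u + c * cnj d * u"
      by (simp add: algebra_simps)
    ultimately show ?thesis
      unfolding mem_chordal_isometric_circle[OF assms] power2_norm_linear_form
      by (simp only: gcircle_def plus_complex.sel) (auto simp: Fin algebra_simps split: if_splits)
  next
    case Infty
    then show ?thesis
      unfolding mem_chordal_isometric_circle[OF assms] by (auto simp: gcircle_def)
  qed
qed

text \<open>The columns are orthogonal and share the squared norm |p|^2 + |q|^2, so
  \<open>scale\<close> is constant; this constant is also the modulus of the determinant.\<close>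

lemma chordal_isometry_anti_unitary:
  assumes "(norm p)\<^sup>2 + (norm q)\<^sup>2 \<noteq> 0"
  shows "chordal_isometry (anti_moebius_map p (- q) (- cnj q) (- cnj p))"
proof -
  let ?k = "(norm p)\<^sup>2 + (norm q)\<^sup>2"
  have det: "p * (- cnj p) - (- q) * (- cnj q) = - of_real ?k"
    by (simp add: of_real_norm_power2)
  have "a * cnj b + c * cnj d = 0" if "a = p" "b = - q" "c = - cnj q" "d = - cnj p" for a b c d
    using that by simp
  then have "scale p (- q) (- cnj q) (- cnj p) z = ?k" for z
    unfolding scale_stereo by (simp add: field_simps)
  moreover have "norm (- complex_of_real ?k) = ?k" by (simp only: norm_minus_cancel norm_of_real) simp
  moreover have "- complex_of_real ?k \<noteq> 0"
    using assms by (simp only: neg_equal_0_iff_equal of_real_eq_0_iff not_False_eq_True)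
  ultimately show ?thesis
    by (intro chordal_isometry_anti_moebius_map chordal_isometry_moebius_map) (simp_all only: det not_False_eq_True)
qed

lemma moebius_map_comp_greflection:
  assumes "a * d - b * c = 1"
    and "(norm a)\<^sup>2 + (norm b)\<^sup>2 + (norm c)\<^sup>2 + (norm d)\<^sup>2 - 2 > 0"
  shows "moebius_map a b c d \<circ>
      greflection (1 - ((norm a)\<^sup>2 + (norm c)\<^sup>2)) (cnj a * b + cnj c * d) (1 - ((norm b)\<^sup>2 + (norm d)\<^sup>2)) =
    anti_moebius_map (b + cnj c) (- (a - cnj d)) (- (cnj a - d)) (- (cnj b + c))"
proof -
  define p \<alpha> \<beta> where "p = cnj a * b + cnj c * d"
    and "\<alpha> = 1 - ((norm a)\<^sup>2 + (norm c)\<^sup>2)" and "\<beta> = 1 - ((norm b)\<^sup>2 + (norm d)\<^sup>2)"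
  have \<alpha>: "complex_of_real \<alpha> = 1 - (a * cnj a + c * cnj c)"
    and \<beta>: "complex_of_real \<beta> = 1 - (b * cnj b + d * cnj d)"
    by (simp_all add: \<alpha>_def \<beta>_def of_real_norm_power2)
  have disc: "(norm p)\<^sup>2 - \<alpha> * \<beta> > 0"
    using det_one_discriminant[OF assms(1)] assms(2) by (simp add: p_def \<alpha>_def \<beta>_def)
  \<comment> \<open>The determinant of the reflection matrix is minus the discriminant, hence
    nonzero.\<close>
  have "p * (- cnj p) - (- of_real \<beta>) * of_real \<alpha> = - of_real ((norm p)\<^sup>2 - \<alpha> * \<beta>)"
    by (simp add: of_real_norm_power2)
  also have "\<dots> \<noteq> (0 :: complex)" using disc by (metis neg_equal_0_iff_equal of_real_eq_0_iff less_irrefl)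
  finally have det: "p * (- cnj p) - (- of_real \<beta>) * of_real \<alpha> \<noteq> 0" .
  \<comment> \<open>The entries of the matrix product. For instance the first is
    \<open>b + cnj c * (a * d - b * c)\<close>, and the determinant is 1.\<close>
  have "a * p + b * of_real \<alpha> = b + cnj c" "a * (- of_real \<beta>) + b * (- cnj p) = - (a - cnj d)"
    "c * p + d * of_real \<alpha> = - (cnj a - d)" "c * (- of_real \<beta>) + d * (- cnj p) = - (cnj b + c)"
    using assms(1) unfolding \<alpha> \<beta> p_def complex_cnj_add complex_cnj_mult complex_cnj_cnj by algebra+
  then have "moebius_map a b c d \<circ> moebius_map p (- of_real \<beta>) (of_real \<alpha>) (- cnj p) =
      moebius_map (b + cnj c) (- (a - cnj d)) (- (cnj a - d)) (- (cnj b + c))"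
    using moebius_map_comp[OF _ det, of a d b c] assms(1) by simp
  then show ?thesis
    unfolding p_def[symmetric] \<alpha>_def[symmetric] \<beta>_def[symmetric]
    by (simp add: fun_eq_iff greflection_def anti_moebius_map_def)
qed

text \<open>The definite articles in "the reflection" and "the isometry" become an existence and a
  uniqueness clause. The conjuncts \<open>r > 0\<close> and
  \<open>a * cnj b + c * cnj d \<noteq> 0\<close> exclude a degenerate circle or line.\<close>

theorem theorem2p3:
  fixes a b c d :: complex
  assumes "a * d - b * c = 1"
    and "\<not> chordal_isometry (moebius_map a b c d)"
  shows
    "(\<exists>R S. is_reflection_across (chordal_isometric_circle (moebius_map a b c d)) R \<and>
        chordal_isometry S \<and> moebius_map a b c d = S \<circ> R) \<and>
     (\<forall>R S. is_reflection_across (chordal_isometric_circle (moebius_map a b c d)) R \<and>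
        chordal_isometry S \<and> moebius_map a b c d = S \<circ> R \<longrightarrow>
        S = anti_moebius_map (b + cnj c) (- (a - cnj d)) (- (cnj a - d)) (- (cnj b + c)) \<and>
        R = anti_moebius_map (cnj a * b + cnj c * d)
              (- of_real (1 - ((norm b)\<^sup>2 + (norm d)\<^sup>2)))
              (of_real (1 - ((norm a)\<^sup>2 + (norm c)\<^sup>2)))
              (- (a * cnj b + c * cnj d))) \<and>
     ((norm a)\<^sup>2 + (norm c)\<^sup>2 \<noteq> 1 \<longrightarrow>
        (let z\<^sub>\<chi> = (cnj a * b + cnj c * d) / of_real (1 - ((norm a)\<^sup>2 + (norm c)\<^sup>2));
             r = sqrt ((norm a)\<^sup>2 + (norm b)\<^sup>2 + (norm c)\<^sup>2 + (norm d)\<^sup>2 - 2)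
                 / \<bar>1 - ((norm a)\<^sup>2 + (norm c)\<^sup>2)\<bar>
         in r > 0 \<and> chordal_isometric_circle (moebius_map a b c d) = Fin ` {z. norm (z - z\<^sub>\<chi>) = r})) \<and>
     ((norm a)\<^sup>2 + (norm c)\<^sup>2 = 1 \<longrightarrow>
        a * cnj b + c * cnj d \<noteq> 0 \<and>
        chordal_isometric_circle (moebius_map a b c d) =
          insert Infty (Fin ` {z. 2 * Re ((a * cnj b + c * cnj d) * z) = 1 - ((norm b)\<^sup>2 + (norm d)\<^sup>2)}))"
proof -
  let ?g = "moebius_map a b c d"
  let ?R = "anti_moebius_map (cnj a * b + cnj c * d)
              (- of_real (1 - ((norm b)\<^sup>2 + (norm d)\<^sup>2)))
              (of_real (1 - ((norm a)\<^sup>2 + (norm c)\<^sup>2)))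
              (- (a * cnj b + c * cnj d))"
  let ?S = "anti_moebius_map (b + cnj c) (- (a - cnj d)) (- (cnj a - d)) (- (cnj b + c))"
  define p \<alpha> \<beta> where "p = cnj a * b + cnj c * d"
    and "\<alpha> = 1 - ((norm a)\<^sup>2 + (norm c)\<^sup>2)" and "\<beta> = 1 - ((norm b)\<^sup>2 + (norm d)\<^sup>2)"
  note abbr = p_def[symmetric] \<alpha>_def[symmetric] \<beta>_def[symmetric]
  have cnj_p: "cnj p = a * cnj b + c * cnj d" by (simp add: p_def)
  have R: "?R = greflection \<alpha> p \<beta>"
    by (simp add: greflection_def p_def \<alpha>_def \<beta>_def)
  let ?\<Delta> = "(norm a)\<^sup>2 + (norm b)\<^sup>2 + (norm c)\<^sup>2 + (norm d)\<^sup>2 - 2"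
  have \<Delta>: "?\<Delta> > 0" by (rule not_chordal_isometry_imp[OF assms])
  have disc_eq: "(norm p)\<^sup>2 - \<alpha> * \<beta> = ?\<Delta>"
    using det_one_discriminant[OF assms(1)] by (simp only: abbr)
  have disc: "(norm p)\<^sup>2 - \<alpha> * \<beta> > 0" using \<Delta> by (simp only: disc_eq)
  have circ: "chordal_isometric_circle ?g = gcircle \<alpha> p \<beta>"
    using chordal_isometric_circle_moebius_map[OF assms(1)] by (simp only: abbr)
  have gR: "?g \<circ> ?R = ?S"
    unfolding R using moebius_map_comp_greflection[OF assms(1) \<Delta>] by (simp only: abbr)
  have RR: "?R \<circ> ?R = id" unfolding R by (rule greflection_involution[OF disc])
  have isoS: "chordal_isometry ?S"
  proof -
    \<comment> \<open>This is the constant of \<open>chordal_isometry_anti_unitary\<close> for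
      \<open>b + cnj c\<close> and \<open>a - cnj d\<close>; as the determinant is 1, it equals the
      positive discriminant.\<close>
    have "(norm (b + cnj c))\<^sup>2 + (norm (a - cnj d))\<^sup>2 = ?\<Delta> + 2 * Re (1 - (a * d - b * c))"
      by (simp only: cmod_power2) (simp add: power2_eq_square algebra_simps)
    then have "(norm (b + cnj c))\<^sup>2 + (norm (a - cnj d))\<^sup>2 \<noteq> 0"
      using \<Delta> by (simp add: assms(1))
    from chordal_isometry_anti_unitary[OF this] show ?thesis by simp
  qed
  have reflR: "is_reflection_across (chordal_isometric_circle ?g) ?R"
    unfolding circ R by (rule is_reflection_across_greflection[OF disc])
  \<comment> \<open>Since \<open>?R\<close> is an involution, \<open>?g\<close> is recovered from
    \<open>?g \<circ> ?R\<close> by composing with \<open>?R\<close> again.\<close>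
  have gSR: "?g = ?S \<circ> ?R"
    unfolding gR[symmetric] comp_assoc RR by simp
  have uniq: "S = ?S \<and> R = ?R"
    if *: "is_reflection_across (chordal_isometric_circle ?g) R" "?g = S \<circ> R" for R S
  proof -
    have RR': "R = ?R"
      using is_reflection_across_gcircle_unique[OF disc] *(1) unfolding circ R .
    \<comment> \<open>Once \<open>R\<close> is known to be \<open>?R\<close>, cancelling the
      involution identifies \<open>S\<close> with \<open>?S\<close>.\<close>
    have "?S = (S \<circ> ?R) \<circ> ?R" unfolding gR[symmetric] *(2) RR' ..
    then show ?thesis unfolding comp_assoc RR by (simp add: RR')
  qed
  have circle: "sqrt ?\<Delta> / \<bar>\<alpha>\<bar> > 0 \<and>
      chordal_isometric_circle ?g = Fin ` {z. norm (z - p / of_real \<alpha>) = sqrt ?\<Delta> / \<bar>\<alpha>\<bar>}"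
    if "(norm a)\<^sup>2 + (norm c)\<^sup>2 \<noteq> 1"
  proof -
    have \<alpha>: "\<alpha> \<noteq> 0" using that by (simp add: \<alpha>_def)
    have "sphere (p / of_real \<alpha>) (sqrt ?\<Delta> / \<bar>\<alpha>\<bar>) = {z. norm (z - p / of_real \<alpha>) = sqrt ?\<Delta> / \<bar>\<alpha>\<bar>}"
      by (auto simp: dist_norm norm_minus_commute)
    then show ?thesis
      using gcircle_eq_sphere[OF \<alpha> disc] \<Delta> \<alpha> unfolding circ disc_eq by simp
  qed
  have line: "cnj p \<noteq> 0 \<and> chordal_isometric_circle ?g =
      insert Infty (Fin ` {z. 2 * Re (cnj p * z) = \<beta>})" if "(norm a)\<^sup>2 + (norm c)\<^sup>2 = 1"
  proof -
    have "\<alpha> = 0" using that by (simp add: \<alpha>_def)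
    \<comment> \<open>For \<alpha> = 0 the discriminant is |p|^2, so its positivity gives a nonzero
      normal.\<close>
    then show ?thesis using disc by (auto simp: circ gcircle_eq_line)
  qed
  show ?thesis
    unfolding Let_def
    using reflR isoS gSR uniq circle[unfolded p_def \<alpha>_def] line[unfolded cnj_p \<beta>_def]
    by blast
qed

end
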